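(* Let $G=(V,E)$ be a connected, undirected graph with vertex set $V=\{1,\dots,N\}$ and edge set $E\subset\{(n,m)\in V\times V : n<m\}$, let $\boldsymbol{y}=(\boldsymbol{y}_n)_{n\in V}\in\mathbb{R}^N$, and let $\lambda>0$. Let $\boldsymbol{x}^*\in\mathbb{B}_1^N=[-1,1]^N$ be a solution of the relaxed problem $$\operatorname*{arg\,min}_{\boldsymbol{x}\in\mathbb{R}^N}\ \mathcal{K}(\boldsymbol{x})\quad\text{s.t.}\quad \boldsymbol{x}_n\in\mathbb{B}_1\ \text{ for all } n\in V,\qquad \mathcal{K}(\boldsymbol{x})=-\sum_{n\in V}\boldsymbol{x}_n\boldsymbol{y}_n+\lambda\sum_{(n,m)\in E}|\boldsymbol{x}_n-\boldsymbol{x}_m|.$$ Then, for (Lebesgue-)almost all $\eta\in[-1,1]$, the binary signal $\chi_\eta(\boldsymbol{x}^* )\in\mathbb{S}_0^N=\{-1,1\}^N$ is a solution of the original non-convex problem $$\operatorname*{arg\,min}_{\boldsymbol{x}\in\mathbb{S}_0^N}\ \frac12\sum_{n\in V}|\boldsymbol{x}_n-\boldsymbol{y}_n|^2+\lambda\sum_{(n,m)\in E}|\boldsymbol{x}_n-\boldsymbol{x}_m|.$$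
   Context: Notation: $\mathbb{S}_0=\{\xi\in\mathbb{R}:|\xi|=1\}=\{-1,1\}$ and $\mathbb{B}_1=\{\xi\in\mathbb{R}:|\xi|\le 1\}=[-1,1]$. A "solution" of a minimization problem is a (global) minimizer over the indicated feasible set. For a level $\eta\in[-1,1]$ and $t\in\mathbb{B}_1$, the characteristic is $\chi_\eta(t)=1$ if $t>\eta$ and $\chi_\eta(t)=-1$ if $t\le\eta$; for a signal $\boldsymbol{x}=(\boldsymbol{x}_n)_{n\in V}\in\mathbb{B}_1^N$ it is applied entrywise, $\chi_\eta(\boldsymbol{x})=(\chi_\eta(\boldsymbol{x}_n))_{n\in V}$. *)

theory Defs
  imports "HOL-Analysis.Analysis" "Graph_Theory.Digraph_Component"
begin

text \<open>
  Signals on the vertices \<open>{1..N}\<close> are extensional functions, so that \<open>{1..N} \<rightarrow>\<^sub>E S\<close> is the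
  \<open>N\<close>-fold Cartesian power of \<open>S\<close>. Here \<open>S\<close> is \<^term>\<open>cball (0 :: real) 1\<close> or
  \<^term>\<open>sphere (0 :: real) 1\<close>.
\<close>

text \<open>
  The edges are given as a set of ordered pairs, one orientation for each edge. The library's
  \<open>connected\<close> passes to the symmetric closure of the arcs before asking for reachability,
  and it requires a nonempty vertex set. Its name is qualified because topological connectedness
  is also called \<open>connected\<close>.
\<close>

definition connected_graph :: "nat \<Rightarrow> (nat \<times> nat) set \<Rightarrow> bool" where
  "connected_graph N E \<longleftrightarrow>
     E \<subseteq> {(n, m). n \<in> {1..N} \<and> m \<in> {1..N} \<and> n < m} \<and>
     Digraph_Component.connected (with_proj \<lparr>pverts = {1..N}, parcs = E\<rparr>)"

definition total_variation :: "(nat \<times> nat) set \<Rightarrow> (nat \<Rightarrow> real) \<Rightarrow> real" where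
  "total_variation E x = (\<Sum>(n, m)\<in>E. \<bar>x n - x m\<bar>)"

definition relaxed_objective ::
    "nat \<Rightarrow> (nat \<times> nat) set \<Rightarrow> (nat \<Rightarrow> real) \<Rightarrow> real \<Rightarrow> (nat \<Rightarrow> real) \<Rightarrow> real" where
  "relaxed_objective N E y c x = - (\<Sum>n\<in>{1..N}. x n * y n) + c * total_variation E x"

definition original_objective ::
    "nat \<Rightarrow> (nat \<times> nat) set \<Rightarrow> (nat \<Rightarrow> real) \<Rightarrow> real \<Rightarrow> (nat \<Rightarrow> real) \<Rightarrow> real" where
  "original_objective N E y c x =
     1 / 2 * (\<Sum>n\<in>{1..N}. \<bar>x n - y n\<bar>\<^sup>2) + c * total_variation E x"

definition characteristic :: "real \<Rightarrow> real \<Rightarrow> real" where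
  "characteristic \<eta> t = (if t > \<eta> then 1 else - 1)"

definition characteristic_signal :: "nat \<Rightarrow> real \<Rightarrow> (nat \<Rightarrow> real) \<Rightarrow> nat \<Rightarrow> real" where
  "characteristic_signal N \<eta> x = (\<lambda>n\<in>{1..N}. characteristic \<eta> (x n))"

end

theory Submission
  imports Defs
begin

text \<open>
  The relaxation is tight because its objective \<open>\<K>\<close> is linear along level sets. For
  \<open>t \<in> [-1, 1]\<close> the characteristics \<open>\<chi>\<^sub>\<eta>(t)\<close> average to \<open>t\<close> over \<open>\<eta> \<in> [-1, 1]\<close>. Moreover
  \<open>\<chi>\<^sub>\<eta>\<close> is monotone, so for each \<open>\<eta>\<close> the difference \<open>\<chi>\<^sub>\<eta>(s) - \<chi>\<^sub>\<eta>(t)\<close> has the sign of \<open>s - t\<close> or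
  vanishes, and the absolute differences average to \<open>\<bar>s - t\<bar>\<close>. Summing over vertices and edges
  gives a coarea formula: \<open>\<K>(x)\<close> is the average of \<open>\<K>(\<chi>\<^sub>\<eta>(x))\<close>
  (\<open>average_relaxed_objective_characteristic\<close>).

  Each \<open>\<chi>\<^sub>\<eta>(x)\<close> is feasible for the relaxed problem, so if \<open>x\<close> is a minimizer, no
  \<open>\<K>(\<chi>\<^sub>\<eta>(x))\<close> lies below the average \<open>\<K>(x)\<close>; hence almost all of them are equal to it. Such a
  \<open>\<chi>\<^sub>\<eta>(x)\<close> minimizes \<open>\<K>\<close> over the cube and therefore over the binary signals. There the
  quadratic data term differs from the linear one only by a constant, since \<open>x\<^sub>n\<^sup>2 = 1\<close>
  (\<open>original_objective_binary\<close>), so \<open>\<chi>\<^sub>\<eta>(x)\<close> also solves the original problem.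
\<close>

lemma integral_characteristic:
  assumes "t \<in> cball 0 1"
  shows "has_bochner_integral lborel (\<lambda>\<eta>. indicator {-1..1} \<eta> * characteristic \<eta> t) (2 * t)"
proof -
  have t: "-1 \<le> t" "t \<le> 1"
    using assms by auto
  have "has_bochner_integral lborel
          (\<lambda>\<eta>. indicat_real {-1..<t} \<eta> - indicat_real {t..1} \<eta>)
          (measure lborel {-1..<t} - measure lborel {t..1})"
    using t by (intro has_bochner_integral_diff has_bochner_integral_real_indicator) auto
  also have "(\<lambda>\<eta>. indicat_real {-1..<t} \<eta> - indicat_real {t..1} \<eta>) =
      (\<lambda>\<eta>. indicator {-1..1} \<eta> * characteristic \<eta> t)"
    using t by (auto simp: fun_eq_iff indicator_def characteristic_def)
  also have "measure lborel {-1..<t} - measure lborel {t..1} = 2 * t"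
    using t by simp
  finally show ?thesis .
qed

text \<open>
  By symmetry it suffices to treat \<open>t \<le> s\<close>. Monotonicity of the characteristic then allows the
  absolute value to be dropped, so that the integral is linear in the two characteristics.
\<close>

lemma integral_abs_diff_characteristic:
  assumes "s \<in> cball 0 1" "t \<in> cball 0 1"
  shows "has_bochner_integral lborel
    (\<lambda>\<eta>. indicator {-1..1} \<eta> * \<bar>characteristic \<eta> s - characteristic \<eta> t\<bar>) (2 * \<bar>s - t\<bar>)"
  using assms
proof (induction s t rule: linorder_wlog)
  case (le t s)
  have "has_bochner_integral lborel
      (\<lambda>\<eta>. indicator {-1..1} \<eta> * characteristic \<eta> s - indicator {-1..1} \<eta> * characteristic \<eta> t)
      (2 * s - 2 * t)"
    using le by (intro has_bochner_integral_diff integral_characteristic)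
  also have "(\<lambda>\<eta>. indicator {-1..1} \<eta> * characteristic \<eta> s
        - indicator {-1..1} \<eta> * characteristic \<eta> t) =
      (\<lambda>\<eta>. indicator {-1..1} \<eta> * \<bar>characteristic \<eta> t - characteristic \<eta> s\<bar>)"
    using le(1) by (auto simp: fun_eq_iff characteristic_def indicator_def)
  also have "2 * s - 2 * t = 2 * \<bar>t - s\<bar>"
    using le(1) by simp
  finally show ?case .
next
  case (sym t s)
  then show ?case
    by (simp add: abs_minus_commute)
qed

text \<open>
  The factor 2 is the length of \<open>[-1, 1]\<close>.
\<close>

lemma average_relaxed_objective_characteristic:
  assumes E: "E \<subseteq> {1..N} \<times> {1..N}" and x: "x \<in> {1..N} \<rightarrow> cball 0 1"
  shows "has_bochner_integral lborel
    (\<lambda>\<eta>. indicator {-1..1} \<eta> * relaxed_objective N E y c (characteristic_signal N \<eta> x))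
    (2 * relaxed_objective N E y c x)"
proof -
  let ?I = "indicat_real {-1..1}"
  have data: "has_bochner_integral lborel
      (\<lambda>\<eta>. \<Sum>n\<in>{1..N}. (?I \<eta> * characteristic \<eta> (x n)) * y n) (\<Sum>n\<in>{1..N}. (2 * x n) * y n)"
    using x by (intro has_bochner_integral_sum has_bochner_integral_mult_left
        integral_characteristic) auto
  have tv: "has_bochner_integral lborel
      (\<lambda>\<eta>. \<Sum>e\<in>E. ?I \<eta> * \<bar>characteristic \<eta> (x (fst e)) - characteristic \<eta> (x (snd e))\<bar>)
      (\<Sum>e\<in>E. 2 * \<bar>x (fst e) - x (snd e)\<bar>)"
    using x E by (intro has_bochner_integral_sum integral_abs_diff_characteristic) auto
  have "has_bochner_integral lborel
      (\<lambda>\<eta>. - (\<Sum>n\<in>{1..N}. (?I \<eta> * characteristic \<eta> (x n)) * y n)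
        + c * (\<Sum>e\<in>E. ?I \<eta> * \<bar>characteristic \<eta> (x (fst e)) - characteristic \<eta> (x (snd e))\<bar>))
      (- (\<Sum>n\<in>{1..N}. (2 * x n) * y n) + c * (\<Sum>e\<in>E. 2 * \<bar>x (fst e) - x (snd e)\<bar>))"
    by (intro has_bochner_integral_add has_bochner_integral_minus
        has_bochner_integral_mult_right data tv)
  also have "- (\<Sum>n\<in>{1..N}. (2 * x n) * y n) + c * (\<Sum>e\<in>E. 2 * \<bar>x (fst e) - x (snd e)\<bar>)
      = 2 * relaxed_objective N E y c x"
    unfolding relaxed_objective_def total_variation_def case_prod_unfold mult.assoc
      sum_distrib_left[symmetric]
    by (simp add: right_diff_distrib)
  also have "(\<lambda>\<eta>. - (\<Sum>n\<in>{1..N}. (?I \<eta> * characteristic \<eta> (x n)) * y n)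
        + c * (\<Sum>e\<in>E. ?I \<eta> * \<bar>characteristic \<eta> (x (fst e)) - characteristic \<eta> (x (snd e))\<bar>))
      = (\<lambda>\<eta>. ?I \<eta> * relaxed_objective N E y c (characteristic_signal N \<eta> x))"
  proof
    fix \<eta>
    have "total_variation E (characteristic_signal N \<eta> x) =
        (\<Sum>e\<in>E. \<bar>characteristic \<eta> (x (fst e)) - characteristic \<eta> (x (snd e))\<bar>)"
      unfolding total_variation_def characteristic_signal_def
      using E by (intro sum.cong) auto
    then show "- (\<Sum>n\<in>{1..N}. (?I \<eta> * characteristic \<eta> (x n)) * y n)
        + c * (\<Sum>e\<in>E. ?I \<eta> * \<bar>characteristic \<eta> (x (fst e)) - characteristic \<eta> (x (snd e))\<bar>)
      = ?I \<eta> * relaxed_objective N E y c (characteristic_signal N \<eta> x)"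
      unfolding relaxed_objective_def mult.assoc sum_distrib_left[symmetric]
      by (simp add: characteristic_signal_def indicator_def)
  qed
  finally show ?thesis .
qed

lemma original_objective_binary:
  assumes "z \<in> {1..N} \<rightarrow> sphere 0 1"
  shows "original_objective N E y c z =
    relaxed_objective N E y c z + (\<Sum>n\<in>{1..N}. (1 + (y n)\<^sup>2) / 2)"
proof -
  have "1 / 2 * \<bar>z n - y n\<bar>\<^sup>2 = - (z n * y n) + (1 + (y n)\<^sup>2) / 2" if "n \<in> {1..N}" for n
  proof -
    have "\<bar>z n\<bar> = 1"
      using assms that by auto
    then have "(z n)\<^sup>2 = 1"
      by (metis power2_abs one_power2)
    then show ?thesis
      by (simp add: power2_diff field_simps)
  qed
  then have "1 / 2 * (\<Sum>n\<in>{1..N}. \<bar>z n - y n\<bar>\<^sup>2) =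
      - (\<Sum>n\<in>{1..N}. z n * y n) + (\<Sum>n\<in>{1..N}. (1 + (y n)\<^sup>2) / 2)"
    unfolding sum_distrib_left sum_negf[symmetric] sum.distrib[symmetric]
    by (rule sum.cong[OF refl])
  then show ?thesis
    by (simp add: original_objective_def relaxed_objective_def)
qed

lemma characteristic_signal_binary:
  "characteristic_signal N \<eta> x \<in> {1..N} \<rightarrow>\<^sub>E sphere 0 1"
  by (auto simp: characteristic_signal_def characteristic_def)

lemma binary_minimizer_if_relaxed_minimizer:
  assumes "is_arg_min (relaxed_objective N E y c) (\<lambda>z. z \<in> {1..N} \<rightarrow>\<^sub>E cball 0 1) x"
    and "b \<in> {1..N} \<rightarrow>\<^sub>E sphere 0 1"
    and "relaxed_objective N E y c b = relaxed_objective N E y c x"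
  shows "is_arg_min (original_objective N E y c) (\<lambda>z. z \<in> {1..N} \<rightarrow>\<^sub>E sphere 0 1) b"
proof -
  have "original_objective N E y c b \<le> original_objective N E y c z"
    if z: "z \<in> {1..N} \<rightarrow>\<^sub>E sphere 0 1" for z
  proof -
    have "z \<in> {1..N} \<rightarrow>\<^sub>E cball 0 1"
      using z by (rule subsetD[OF PiE_mono, rotated]) auto
    then have "relaxed_objective N E y c b \<le> relaxed_objective N E y c z"
      using assms(1,3) by (auto simp: is_arg_min_linorder)
    then show ?thesis
      using z assms(2) by (simp add: original_objective_binary PiE_iff)
  qed
  then show ?thesis
    using assms(2) by (simp add: is_arg_min_linorder)
qed

theorem theorem3:
  fixes N :: nat and E :: "(nat \<times> nat) set" and y x :: "nat \<Rightarrow> real" and c :: real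
  assumes "connected_graph N E"
    and "y \<in> {1..N} \<rightarrow>\<^sub>E UNIV"
    and "c > 0"
    and "is_arg_min (relaxed_objective N E y c) (\<lambda>z. z \<in> {1..N} \<rightarrow>\<^sub>E cball 0 1) x"
  shows "AE \<eta>\<in>{-1..1} in lebesgue.
    is_arg_min (original_objective N E y c) (\<lambda>z. z \<in> {1..N} \<rightarrow>\<^sub>E sphere 0 1)
      (characteristic_signal N \<eta> x)"
proof -
  let ?K = "relaxed_objective N E y c"
  let ?excess = "\<lambda>\<eta>. indicator {-1..1} \<eta> * ?K (characteristic_signal N \<eta> x)
    - indicator {-1..1} \<eta> * ?K x"
  have E: "E \<subseteq> {1..N} \<times> {1..N}"
    using assms(1) by (auto simp: connected_graph_def)
  have x: "x \<in> {1..N} \<rightarrow>\<^sub>E cball 0 1"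
    and min: "\<And>z. z \<in> {1..N} \<rightarrow>\<^sub>E cball 0 1 \<Longrightarrow> ?K x \<le> ?K z"
    using assms(4) by (auto simp: is_arg_min_linorder)
  have "has_bochner_integral lborel ?excess (2 * ?K x - measure lborel {-1..1::real} * ?K x)"
    using x by (intro has_bochner_integral_diff average_relaxed_objective_characteristic[OF E]
        has_bochner_integral_mult_left has_bochner_integral_real_indicator) auto
  then have excess: "has_bochner_integral lborel ?excess 0"
    by simp
  have "?K x \<le> ?K (characteristic_signal N \<eta> x)" for \<eta>
    by (rule min, rule subsetD[OF PiE_mono characteristic_signal_binary]) auto
  then have "AE \<eta> in lborel. 0 \<le> ?excess \<eta>"
    by (simp add: indicator_def)
  with excess have "AE \<eta> in lborel. ?excess \<eta> = 0"
    unfolding has_bochner_integral_iff by (subst integral_nonneg_eq_0_iff_AE[symmetric]) auto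
  then have "AE \<eta> in lebesgue. ?excess \<eta> = 0"
    by (rule AE_completion)
  then show ?thesis
  proof (rule AE_mp, intro AE_I2 impI)
    fix \<eta> :: real
    assume "?excess \<eta> = 0" "\<eta> \<in> {-1..1}"
    then have "?K (characteristic_signal N \<eta> x) = ?K x"
      by simp
    then show "is_arg_min (original_objective N E y c) (\<lambda>z. z \<in> {1..N} \<rightarrow>\<^sub>E sphere 0 1)
        (characteristic_signal N \<eta> x)"
      by (rule binary_minimizer_if_relaxed_minimizer[OF assms(4) characteristic_signal_binary])
  qed
qed

end
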